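(* Let $m,n\in\mathbb{N}$ and let $\lambda=(\lambda_1,\lambda_2)$ be a partition with exactly two parts (so $\lambda_1\ge\lambda_2\ge1$). Then for all $\zeta\in\{\eta_m,\epsilon_m\}$ and $\theta\in\{\eta_n,\epsilon_n\}$, $$|B^{\zeta}_{\theta}(\lambda_1,\lambda_2)|\ \ge\ |B^{\zeta}_{\theta}(\lambda_1+1,\lambda_2-1)|.$$
   Context: $\mathbb{N}=\{0,1,2,\dots\}$ and $\mathbb{B}=\{0,1\}$. The symbols $\eta_m,\epsilon_m$ (trivial and sign character of $S_m$) and $\eta_n,\epsilon_n$ serve only as labels here. For $\alpha\in\mathbb{N}^2$, the sets of bipartite superpartitions $B^\zeta_\theta(\alpha)$ are defined as follows. $B^{\eta_m}_{\eta_n}(\alpha)$ (resp. $B^{\eta_m}_{\epsilon_n}(\alpha)$) is the set of tuples $(v_1,\dots,v_m,v'_1,\dots,v'_n)$ with $v_i\in\mathbb{N}^2$ and $v'_j\in\mathbb{B}^2$ such that: (a) $(v_i)_{i=1}^m$ and $(v'_j)_{j=1}^n$ are each weakly increasing in lexicographic order; (b) each element of $\{(1,0),(0,1)\}$ (resp. of $\{(1,1),(0,0)\}$) occurs at most once among $v'_1,\dots,v'_n$; (c) $\sum_{i=1}^m v_i+\sum_{j=1}^n v'_j=\alpha$. $B^{\epsilon_m}_{\eta_n}(\alpha)$ (resp. $B^{\epsilon_m}_{\epsilon_n}(\alpha)$) is the set of tuples in $B^{\eta_m}_{\eta_n}(\alpha)$ (resp. $B^{\eta_m}_{\epsilon_n}(\alpha)$)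 satisfying in addition $v_i\ne v_j$ for all $1\le i<j\le m$. When $m=0$ (resp. $n=0$) there are no $v_i$ (resp. no $v'_j$). *)

theory Defs
  imports "HOL-Library.Product_Lexorder" "HOL-Library.Product_Plus"
begin

text \<open>
  The labels for the trivial character (\<open>Triv\<close>, written \<open>\<eta>\<close>) and the sign character (\<open>Sgn\<close>, written
  \<open>\<epsilon>\<close>) of a symmetric group. The degree of the group is passed separately, so \<open>\<eta>\<^sub>m\<close> is the pair of
  \<open>Triv\<close> and \<open>m\<close>. The two labels stay distinct also for \<open>m \<le> 1\<close>.
\<close>

datatype char_label = Triv | Sgn

primrec nonrepeatable :: "char_label \<Rightarrow> (nat \<times> nat) set" where
  "nonrepeatable Triv = {(1, 0), (0, 1)}"
| "nonrepeatable Sgn = {(1, 1), (0, 0)}"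

text \<open>
  \<open>bipartite_superpartitions \<zeta> m \<theta> n \<alpha>\<close> is the set \<open>B\<close> with upper label \<open>\<zeta>\<^sub>m\<close> and lower label \<open>\<theta>\<^sub>n\<close>
  at \<open>\<alpha>\<close>. A tuple \<open>(v\<^sub>1, \<dots>, v\<^sub>m, v'\<^sub>1, \<dots>, v'\<^sub>n)\<close> is the pair of lists \<open>(v, v')\<close> of lengths \<open>m\<close> and \<open>n\<close>.
  \<open>Product_Lexorder\<close> makes \<open>\<le>\<close> on pairs, and hence \<open>sorted\<close>, lexicographic; \<open>Product_Plus\<close> makes
  \<open>+\<close> on pairs, and hence \<open>sum_list\<close>, componentwise.
\<close>

definition bipartite_superpartitions ::
    "char_label \<Rightarrow> nat \<Rightarrow> char_label \<Rightarrow> nat \<Rightarrow> nat \<times> nat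
      \<Rightarrow> ((nat \<times> nat) list \<times> (nat \<times> nat) list) set" where
  "bipartite_superpartitions \<zeta> m \<theta> n \<alpha> =
    {(v, v'). length v = m \<and> length v' = n \<and> set v' \<subseteq> {0, 1} \<times> {0, 1} \<and>
       sorted v \<and> sorted v' \<and>
       (\<forall>x \<in> nonrepeatable \<theta>. count_list v' x \<le> 1) \<and>
       sum_list v + sum_list v' = \<alpha> \<and>
       (\<zeta> = Sgn \<longrightarrow> (\<forall>i j. i < j \<and> j < m \<longrightarrow> v ! i \<noteq> v ! j))}"

text \<open>Finiteness, so that \<open>card\<close> is the genuine cardinality.\<close>

lemma fst_sum_list: "fst (sum_list v) = sum_list (map fst v)"
  for v :: "(nat \<times> nat) list"
  by (induction v) auto

lemma snd_sum_list: "snd (sum_list v) = sum_list (map snd v)"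
  for v :: "(nat \<times> nat) list"
  by (induction v) auto

lemma finite_bipartite_superpartitions:
  "finite (bipartite_superpartitions \<zeta> m \<theta> n \<alpha>)"
proof -
  let ?A = "{..fst \<alpha>} \<times> {..snd \<alpha>}"
  have sub: "set v \<subseteq> ?A" if "sum_list v + w = \<alpha>" for v and w :: "nat \<times> nat"
  proof
    fix x assume "x \<in> set v"
    then have "fst x \<le> sum_list (map fst v)" "snd x \<le> sum_list (map snd v)"
      by (simp_all add: member_le_sum_list)
    then have "fst x \<le> fst \<alpha>" "snd x \<le> snd \<alpha>"
      using that by (auto simp: fst_sum_list snd_sum_list)
    then show "x \<in> ?A" by (cases x) auto
  qed
  have "bipartite_superpartitions \<zeta> m \<theta> n \<alpha> \<subseteq>
      {v. set v \<subseteq> ?A \<and> length v = m} \<times> {v'. set v' \<subseteq> {0, 1} \<times> {0, 1} \<and> length v' = n}"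
    unfolding bipartite_superpartitions_def using sub by blast
  moreover have "finite ({v. set v \<subseteq> ?A \<and> length v = m} \<times>
      {v' :: (nat \<times> nat) list. set v' \<subseteq> {0, 1} \<times> {0, 1} \<and> length v' = n})"
    by (intro finite_cartesian_product finite_lists_length_eq) auto
  ultimately show ?thesis by (rule finite_subset)
qed

end

theory Submission
  imports Defs Complex_Main "HOL-Library.Multiset"
begin

text \<open>
  The reason behind the inequality is the representation theory of \<open>sl\<^sub>2\<close>: in a finite-dimensional
  representation the lowering operator maps a weight space of positive weight injectively, so the
  dimensions do not increase when the weight moves away from \<open>0\<close>. A bipartite superpartition is a
  configuration of particles on sites. A part \<open>v\<^sub>i = (a, b)\<close> is a particle on the site of the
  monomial \<open>x\<^sup>a y\<^sup>b\<close> in \<open>\<complex>[x, y]\<close>; a part \<open>v'\<^sub>j\<close> is a particle on one of the four basis elements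
  of the exterior algebra on two generators. On both spaces \<open>sl\<^sub>2\<close> acts by \<open>x \<partial>/\<partial>y\<close> and \<open>y \<partial>/\<partial>x\<close>:
  it moves particles along \<open>(a, b) \<mapsto> (a + 1, b - 1)\<close> and back, and it annihilates the basis
  elements \<open>(0, 0)\<close> and \<open>(1, 1)\<close> of the exterior algebra. The configurations of total \<open>\<alpha>\<close> index a basis of
  a weight space of weight \<open>fst \<alpha> - snd \<alpha>\<close> in a tensor product of symmetric and exterior powers,
  taken in the graded sense for the parts \<open>v'\<^sub>j\<close>: there the two generators are odd, so they are the
  ones that cannot be repeated in a symmetric power, and \<open>1\<close> and the product of the generators are
  the ones that cannot be repeated in an exterior power.

  The argument needs no representation, only the two operators on real functions of
  configurations. Both move one particle by one step, with a factor for the length of the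
  remaining chain, and forbid moves onto an occupied exclusive site. No signs occur for exterior
  powers, because a particle moves to the neighbouring site of its chain and so never passes another
  particle of the same chain. The commutator of the two operators is multiplication by the weight
  (lemma \<open>commutator\<close>).

  Suppose that there are fewer configurations of total \<open>(l1, l2)\<close> than of total \<open>(l1 + 1, l2 - 1)\<close>.
  The operator \<open>R\<close> gives at \<open>X\<close> a combination of the values at the configurations that are reached
  from \<open>X\<close> by a raising move, so it takes functions on the second family to functions on the first,
  and some nonzero \<open>x\<close> lies in its kernel (lemma \<open>exists_nontrivial_solution\<close>). Applying the
  corresponding operator \<open>L\<close> for lowering moves repeatedly to \<open>x\<close> gives
  \<open>0\<close> after finitely many steps. By the commutator, \<open>R (L\<^sup>k\<^sup>+\<^sup>1 x)\<close> is a multiple of \<open>L\<^sup>k x\<close>, and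
  the factor is nonzero because the weight of \<open>L\<^sup>k x\<close> is positive for every \<open>k\<close>. Going back
  from the vanishing power to \<open>k = 0\<close> yields \<open>x = 0\<close>, a contradiction (lemma \<open>card_le_if_weight_pos\<close>).
\<close>

section \<open>Homogeneous linear systems\<close>

text \<open>Gaussian elimination, one equation at a time.\<close>

lemma exists_nontrivial_solution:
  fixes M :: "'b \<Rightarrow> 'a \<Rightarrow> 'k::field"
  assumes "finite B" "finite A" "card B < card A"
  shows "\<exists>x. (\<exists>a\<in>A. x a \<noteq> 0) \<and> (\<forall>a. a \<notin> A \<longrightarrow> x a = 0) \<and> (\<forall>b\<in>B. (\<Sum>a\<in>A. M b a * x a) = 0)"
  using assms
proof (induction B arbitrary: A M rule: finite_induct)
  case empty
  then obtain a where "a \<in> A" by fastforce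
  then show ?case by (intro exI[of _ "\<lambda>x. if x = a then 1 else 0"]) auto
next
  case (insert b B)
  have lt: "card B < card A" using insert by simp
  show ?case
  proof (cases "\<forall>a\<in>A. M b a = 0")
    case True
    obtain x where "\<exists>a\<in>A. x a \<noteq> 0" "\<forall>a. a \<notin> A \<longrightarrow> x a = 0" "\<forall>c\<in>B. (\<Sum>a\<in>A. M c a * x a) = 0"
      using insert.IH[OF insert.prems(1) lt, of M] by blast
    then show ?thesis using True by (intro exI[of _ x]) auto
  next
    case False
    then obtain d where d: "d \<in> A" "M b d \<noteq> 0" by blast
    define A' where "A' = A - {d}"
    have A': "finite A'" "d \<notin> A'" "A = insert d A'" using d insert.prems by (auto simp: A'_def)
    have "card B < card A'" using A' insert by simp
    from insert.IH[OF A'(1) this, of "\<lambda>c a. M c a - M c d * M b a / M b d"]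
    obtain x where x: "\<exists>a\<in>A'. x a \<noteq> 0" "\<forall>a. a \<notin> A' \<longrightarrow> x a = 0"
      and eq: "\<forall>c\<in>B. (\<Sum>a\<in>A'. (M c a - M c d * M b a / M b d) * x a) = 0" by blast
    \<comment> \<open>The unknown at the pivot \<open>d\<close> is chosen so that equation \<open>b\<close> holds.\<close>
    define y where "y = x(d := - (\<Sum>a\<in>A'. M b a * x a) / M b d)"
    have sum_y: "(\<Sum>a\<in>A. M c a * y a) = (\<Sum>a\<in>A'. (M c a - M c d * M b a / M b d) * x a)" for c
    proof -
      have "(\<Sum>a\<in>A'. M c a * y a) = (\<Sum>a\<in>A'. M c a * x a)"
        using A' by (intro sum.cong) (auto simp: y_def)
      then have "(\<Sum>a\<in>A. M c a * y a) = M c d * y d + (\<Sum>a\<in>A'. M c a * x a)"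
        using A' by simp
      also have "M c d * y d = - (\<Sum>a\<in>A'. M c d * M b a / M b d * x a)"
        by (simp add: y_def sum_distrib_left sum_divide_distrib ac_simps sum_negf)
      finally show ?thesis by (simp add: left_diff_distrib sum_subtractf)
    qed
    have "\<exists>a\<in>A. y a \<noteq> 0" "\<forall>a. a \<notin> A \<longrightarrow> y a = 0" using x A' by (auto simp: y_def)
    moreover have "\<forall>c\<in>insert b B. (\<Sum>a\<in>A. M c a * y a) = 0"
      using eq d by (auto simp: sum_y)
    ultimately show ?thesis by blast
  qed
qed

section \<open>Ladders and hopping operators\<close>

text \<open>
  A ladder is a set of sites that splits into chains. The numbers \<open>below p\<close> and \<open>above p\<close> count the
  sites of the chain of \<open>p\<close> on either side of \<open>p\<close>; at the ends of a chain the values of \<open>lower\<close> and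
  \<open>raise\<close> are arbitrary. A site \<open>p\<close> with \<open>excl p\<close> holds at most one particle, and this property is
  constant along a chain.
\<close>

locale ladder =
  fixes lower raise :: "'s \<Rightarrow> 's" and below above :: "'s \<Rightarrow> nat" and excl :: "'s \<Rightarrow> bool"
  assumes raise_lower: "below p > 0 \<Longrightarrow> raise (lower p) = p"
    and above_lower: "below p > 0 \<Longrightarrow> above (lower p) = Suc (above p)"
    and below_lower: "below p > 0 \<Longrightarrow> below p = Suc (below (lower p))"
    and excl_lower: "below p > 0 \<Longrightarrow> excl (lower p) = excl p"
    and lower_raise: "above p > 0 \<Longrightarrow> lower (raise p) = p"
    and below_raise: "above p > 0 \<Longrightarrow> below (raise p) = Suc (below p)"
    and above_raise: "above p > 0 \<Longrightarrow> above p = Suc (above (raise p))"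
    and excl_raise: "above p > 0 \<Longrightarrow> excl (raise p) = excl p"
begin

definition admissible :: "'s multiset \<Rightarrow> bool" where
  "admissible X \<longleftrightarrow> (\<forall>p. excl p \<longrightarrow> count X p \<le> 1)"

definition room :: "'s multiset \<Rightarrow> 's \<Rightarrow> real" where
  "room X t = (if excl t \<and> t \<in># X then 0 else 1)"

definition shift :: "('s \<Rightarrow> 's) \<Rightarrow> 's \<Rightarrow> 's multiset \<Rightarrow> 's multiset" where
  "shift s p X = add_mset (s p) (X - {#p#})"

text \<open>
  The functions below take a direction \<open>s\<close>, with the number \<open>c\<close> of steps that are possible in that
  direction: \<open>lower\<close> with \<open>below\<close>, or \<open>raise\<close> with \<open>above\<close>. At the end of a chain \<open>c p = 0\<close>, which
  suppresses the meaningless value \<open>s p\<close>. With these factors, a chain of length \<open>d + 1\<close> carries the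
  irreducible representation of \<open>sl\<^sub>2\<close> on the monomials of degree \<open>d\<close> in two variables.
\<close>

definition amp :: "('s \<Rightarrow> 's) \<Rightarrow> ('s \<Rightarrow> nat) \<Rightarrow> 's multiset \<Rightarrow> 's \<Rightarrow> real" where
  "amp s c X p = real (count X p * c p) * room X (s p)"

text \<open>
  The operators are transposed: the value at \<open>X\<close> collects values at the configurations reached from
  \<open>X\<close>. Hence they are defined on all functions, without a condition of finite support.
\<close>

definition hop :: "('s \<Rightarrow> 's) \<Rightarrow> ('s \<Rightarrow> nat) \<Rightarrow> ('s multiset \<Rightarrow> real) \<Rightarrow> 's multiset \<Rightarrow> real" where
  "hop s c f X = (\<Sum>p\<in>set_mset X. amp s c X p * f (shift s p X))"

abbreviation "L \<equiv> hop lower below"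
abbreviation "R \<equiv> hop raise above"

definition weight :: "'s multiset \<Rightarrow> int" where
  "weight X = (\<Sum>p\<in>#X. int (below p) - int (above p))"

lemma weight_eq_sum:
  "real_of_int (weight X) = (\<Sum>p\<in>set_mset X. real (count X p) * (real (below p) - real (above p)))"
proof (induction X)
  case (add q X)
  have "(\<Sum>p\<in>set_mset (add_mset q X). real (count (add_mset q X) p) * (real (below p) - real (above p)))
    = (\<Sum>p\<in>insert q (set_mset X). real (count X p) * (real (below p) - real (above p))
        + (if p = q then real (below q) - real (above q) else 0))"
    by (intro sum.cong) (auto simp: algebra_simps)
  also have "\<dots> = (\<Sum>p\<in>insert q (set_mset X). real (count X p) * (real (below p) - real (above p)))
      + (real (below q) - real (above q))"
    by (simp add: sum.distrib)
  also have "(\<Sum>p\<in>insert q (set_mset X). real (count X p) * (real (below p) - real (above p)))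
    = (\<Sum>p\<in>set_mset X. real (count X p) * (real (below p) - real (above p)))"
    by (intro sum.mono_neutral_right) (auto simp: not_in_iff)
  finally show ?case using add by (simp add: weight_def)
qed (simp add: weight_def)

lemma hop_superset:
  assumes "finite S" "set_mset X \<subseteq> S"
  shows "hop s c f X = (\<Sum>p\<in>S. amp s c X p * f (shift s p X))"
  unfolding hop_def using assms
  by (intro sum.mono_neutral_left) (auto simp: amp_def not_in_iff)

lemma amp_nonzero:
  assumes "amp s c X p \<noteq> 0"
  shows "p \<in># X" "c p > 0" "excl (s p) \<Longrightarrow> s p \<notin># X"
  using assms by (auto simp: amp_def room_def not_in_iff split: if_splits)

lemma lower_neq: "below p > 0 \<Longrightarrow> lower p \<noteq> p"
  using below_lower[of p] by force

lemma raise_neq: "above p > 0 \<Longrightarrow> raise p \<noteq> p"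
  using above_raise[of p] by force

text \<open>
  The operators only look at admissible configurations when they start from one. So identities
  between functions are needed on admissible configurations only.
\<close>

lemma admissible_lower:
  assumes "admissible X" "amp lower below X p \<noteq> 0"
  shows "admissible (shift lower p X)"
  using assms amp_nonzero[OF assms(2)]
  by (auto simp: admissible_def shift_def not_in_iff le_diff_conv intro: le_SucI)

lemma admissible_raise:
  assumes "admissible X" "amp raise above X p \<noteq> 0"
  shows "admissible (shift raise p X)"
  using assms amp_nonzero[OF assms(2)]
  by (auto simp: admissible_def shift_def not_in_iff le_diff_conv intro: le_SucI)

lemma hop_cong_admissible:
  assumes "admissible X" "\<And>p. amp s c X p \<noteq> 0 \<Longrightarrow> f (shift s p X) = g (shift s p X)"
  shows "hop s c f X = hop s c g X"
  unfolding hop_def using assms by (intro sum.cong) fastforce+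

text \<open>
  Unless the second move undoes the first, the two moves can be exchanged. The factor \<open>room\<close> for one
  move changes through the other only if both particles go to the same site \<open>lower p = raise q\<close>; then
  both orders are forbidden if that site is exclusive.
\<close>

lemma commute_distinct:
  assumes "\<not> (below p > 0 \<and> q = lower p)"
  shows "amp lower below X p * (amp raise above (shift lower p X) q * f (shift raise q (shift lower p X)))
       = amp raise above X q * (amp lower below (shift raise q X) p * f (shift lower p (shift raise q X)))"
proof (cases "below p > 0 \<and> above q > 0 \<and> {#p, q#} \<subseteq># X")
  case True
  then have pq: "below p > 0" "above q > 0" by auto
  obtain Y where X: "X = add_mset p (add_mset q Y)"
    using True by (auto simp: mset_subset_eq_exists_conv)
  have ne: "q \<noteq> lower p" "raise q \<noteq> p" "lower p \<noteq> p" "raise q \<noteq> q"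
    using assms pq lower_raise lower_neq raise_neq by auto
  have shifts: "shift lower p X = add_mset (lower p) (add_mset q Y)"
      "shift raise q X = add_mset (raise q) (add_mset p Y)"
      "shift raise q (add_mset (lower p) (add_mset q Y)) = add_mset (raise q) (add_mset (lower p) Y)"
      "shift lower p (add_mset (raise q) (add_mset p Y)) = add_mset (raise q) (add_mset (lower p) Y)"
    using ne by (simp_all add: X shift_def add_mset_commute)
  have rooms: "room X (lower p) * room (add_mset (lower p) (add_mset q Y)) (raise q)
      = room X (raise q) * room (add_mset (raise q) (add_mset p Y)) (lower p)"
    using ne by (cases "lower p = raise q") (simp_all add: X room_def)
  have counts: "count X p * count (add_mset (lower p) (add_mset q Y)) q
      = count X q * count (add_mset (raise q) (add_mset p Y)) p"
    using ne by (cases "p = q") (simp_all add: X)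
  have "amp lower below X p * amp raise above (add_mset (lower p) (add_mset q Y)) q
      = real (count X p * count (add_mset (lower p) (add_mset q Y)) q) * (real (below p) * real (above q))
        * (room X (lower p) * room (add_mset (lower p) (add_mset q Y)) (raise q))"
    by (simp only: amp_def of_nat_mult ac_simps)
  also have "\<dots> = amp raise above X q * amp lower below (add_mset (raise q) (add_mset p Y)) p"
    unfolding rooms counts by (simp only: amp_def of_nat_mult ac_simps)
  finally show ?thesis unfolding shifts mult.assoc[symmetric] by simp
next
  case False
  have le: "count (shift raise q X) p \<le> count X p" if "above q > 0" "below p > 0"
    using that assms lower_raise[of q] by (auto simp: shift_def)
  have le': "count (shift lower p X) q \<le> count X q" if "below p > 0" "above q > 0"
    using that assms by (auto simp: shift_def)
  have *: "count X p = 0 \<or> count X q = 0 \<or> (p = q \<and> count X p = 1)"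
    if "below p > 0" "above q > 0"
  proof -
    have "\<not> {#p, q#} \<subseteq># X" using False that by auto
    then obtain a where "\<not> count {#p, q#} a \<le> count X a"
      by (auto simp: subseteq_mset_def)
    then show ?thesis by (auto simp: not_in_iff split: if_splits)
  qed
  show ?thesis
  proof (cases "below p > 0 \<and> above q > 0")
    case True
    then show ?thesis using * le le' lower_neq[of p] raise_neq[of q]
      by (auto simp: amp_def shift_def)
  qed (auto simp: amp_def)
qed

text \<open>
  Let \<open>a\<close> and \<open>b\<close> be the numbers of particles on the neighbours \<open>p\<close> and \<open>lower p\<close>. Up to the common
  factor from the chain, a particle goes from \<open>p\<close> to \<open>lower p\<close> and back with amplitude \<open>a (1 + b)\<close>,
  or \<open>a (1 - b)\<close> if the sites are exclusive; the opposite round trip has \<open>b (1 + a)\<close>, or \<open>b (1 - a)\<close>.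
  In both cases the difference is \<open>a - b\<close>, which is why both kinds of sites obey the same commutator.
\<close>

lemma return_amplitude:
  assumes "admissible X" "below p > 0"
  shows "amp lower below X p * amp raise above (shift lower p X) (lower p)
       - amp raise above X (lower p) * amp lower below (shift raise (lower p) X) p
       = real (below p) * real (above (lower p)) * (real (count X p) - real (count X (lower p)))"
proof -
  define q where "q = lower p"
  have q: "raise q = p" "q \<noteq> p" "excl q = excl p" "lower p = q"
    using assms raise_lower lower_neq excl_lower by (auto simp: q_def)
  show ?thesis
  proof (cases "excl p")
    case True
    have "count X p = 0 \<or> count X p = 1" "count X q = 0 \<or> count X q = 1"
      using True q assms(1) by (auto simp: admissible_def le_Suc_eq)
    moreover have mem: "t \<in># Z \<longleftrightarrow> count Z t \<noteq> 0" for t and Z :: "'s multiset" by simp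
    ultimately show ?thesis unfolding q(4) using True q
      by (auto simp: amp_def shift_def room_def mem
          simp del: count_eq_zero_iff count_greater_zero_iff)
  next
    case False
    then show ?thesis unfolding q(4) using q
      by (cases "count X p"; cases "count X q") (auto simp: amp_def shift_def room_def algebra_simps)
  qed
qed

text \<open>
  Only the round trips survive. Each particle on \<open>p\<close> contributes
  \<open>below p * (above p + 1) - above p * (below p + 1) = below p - above p\<close>.
\<close>

lemma commutator:
  assumes adm: "admissible X"
  shows "L (R f) X - R (L f) X = real_of_int (weight X) * f X"
proof -
  \<comment> \<open>One finite index set that contains all sites occupied after at most one move.\<close>
  define S where "S = set_mset X \<union> lower ` set_mset X \<union> raise ` set_mset X"
  have S: "finite S" "set_mset X \<subseteq> S" by (auto simp: S_def)
  have LR: "L (R f) X = (\<Sum>p\<in>S. \<Sum>q\<in>S. amp lower below X p *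
      (amp raise above (shift lower p X) q * f (shift raise q (shift lower p X))))"
  proof -
    have "amp lower below X p * R f (shift lower p X) = amp lower below X p *
      (\<Sum>q\<in>S. amp raise above (shift lower p X) q * f (shift raise q (shift lower p X)))" for p
    proof (cases "p \<in># X")
      case True
      then have "set_mset (shift lower p X) \<subseteq> S"
        by (auto simp: shift_def S_def dest: in_diffD)
      then show ?thesis by (simp only: hop_superset[OF S(1)])
    qed (simp add: amp_def not_in_iff)
    then show ?thesis by (simp add: hop_superset[OF S] sum_distrib_left)
  qed
  have RL: "R (L f) X = (\<Sum>p\<in>S. \<Sum>q\<in>S. amp raise above X q *
      (amp lower below (shift raise q X) p * f (shift lower p (shift raise q X))))"
  proof -
    have "amp raise above X q * L f (shift raise q X) = amp raise above X q *
      (\<Sum>p\<in>S. amp lower below (shift raise q X) p * f (shift lower p (shift raise q X)))" for q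
    proof (cases "q \<in># X")
      case True
      then have "set_mset (shift raise q X) \<subseteq> S"
        by (auto simp: shift_def S_def dest: in_diffD)
      then show ?thesis by (simp only: hop_superset[OF S(1)])
    qed (simp add: amp_def not_in_iff)
    then show ?thesis by (subst sum.swap) (simp add: hop_superset[OF S] sum_distrib_left)
  qed
  let ?c = "\<lambda>p. real (count X p)"
  let ?inv = "\<lambda>p q. below p > 0 \<and> q = lower p"
  have term_eq: "amp lower below X p *
        (amp raise above (shift lower p X) q * f (shift raise q (shift lower p X))) -
      amp raise above X q *
        (amp lower below (shift raise q X) p * f (shift lower p (shift raise q X)))
      = (if ?inv p q then real (below p) * real (above q) * (?c p - ?c q) else 0) * f X" for p q
  proof (cases "?inv p q")
    case False
    then show ?thesis
      by (simp only: commute_distinct[OF False, where X=X and f=f] if_False diff_self mult_zero_left)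
  next
    case True
    then have q: "q = lower p" "raise q = p" "q \<noteq> p" using raise_lower lower_neq by auto
    have a: "amp lower below X p * f (shift raise q (shift lower p X)) = amp lower below X p * f X"
      using q by (cases "p \<in># X") (auto simp: shift_def amp_def not_in_iff)
    have b: "amp raise above X q * f (shift lower p (shift raise q X)) = amp raise above X q * f X"
      using q by (cases "q \<in># X") (auto simp: shift_def amp_def not_in_iff)
    have "amp lower below X p *
        (amp raise above (shift lower p X) q * f (shift raise q (shift lower p X))) -
      amp raise above X q *
        (amp lower below (shift raise q X) p * f (shift lower p (shift raise q X)))
      = amp raise above (shift lower p X) q * (amp lower below X p * f (shift raise q (shift lower p X)))
        - amp lower below (shift raise q X) p * (amp raise above X q * f (shift lower p (shift raise q X)))"
      by (simp add: ac_simps)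
    also have "\<dots> = (amp lower below X p * amp raise above (shift lower p X) q
       - amp raise above X q * amp lower below (shift raise q X) p) * f X"
      unfolding a b by (simp add: algebra_simps)
    finally show ?thesis using return_amplitude[OF adm, of p] True by simp
  qed
  have "L (R f) X - R (L f) X =
    (\<Sum>p\<in>S. \<Sum>q\<in>S. (if ?inv p q then real (below p) * real (above q) * (?c p - ?c q) else 0) * f X)"
    unfolding LR RL by (simp only: sum_subtractf[symmetric] term_eq)
  also have "\<dots> = (\<Sum>p\<in>S. \<Sum>q\<in>S. (if ?inv p q then real (below p) * real (above q) * (?c p - ?c q) else 0)) * f X"
    by (simp only: sum_distrib_right)
  also have "(\<Sum>p\<in>S. \<Sum>q\<in>S. (if ?inv p q then real (below p) * real (above q) * (?c p - ?c q) else 0))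
    = (\<Sum>p\<in>S. \<Sum>q\<in>S. if ?inv p q then real (below p) * real (above q) * ?c p else 0)
    - (\<Sum>p\<in>S. \<Sum>q\<in>S. if ?inv p q then real (below p) * real (above q) * ?c q else 0)"
    unfolding sum_subtractf[symmetric] by (intro sum.cong refl) (auto simp: right_diff_distrib)
  also have "(\<Sum>p\<in>S. \<Sum>q\<in>S. if ?inv p q then real (below p) * real (above q) * ?c q else 0)
    = (\<Sum>q\<in>S. \<Sum>p\<in>S. if ?inv p q then real (below p) * real (above q) * ?c q else 0)"
    by (rule sum.swap)
  also have "(\<Sum>p\<in>S. \<Sum>q\<in>S. if ?inv p q then real (below p) * real (above q) * ?c p else 0)
    = (\<Sum>p\<in>S. ?c p * real (below p * Suc (above p)))"
  proof (rule sum.cong[OF refl])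
    fix p assume "p \<in> S"
    show "(\<Sum>q\<in>S. if ?inv p q then real (below p) * real (above q) * ?c p else 0)
      = ?c p * real (below p * Suc (above p))"
    proof (cases "below p > 0 \<and> p \<in># X")
      case True
      then have "lower p \<in> S" by (auto simp: S_def)
      then show ?thesis using True S(1) above_lower[of p] by (simp add: algebra_simps)
    qed (auto simp: not_in_iff intro!: sum.neutral)
  qed
  also have "(\<Sum>q\<in>S. \<Sum>p\<in>S. if ?inv p q then real (below p) * real (above q) * ?c q else 0)
    = (\<Sum>q\<in>S. ?c q * real (above q * Suc (below q)))"
  proof (rule sum.cong[OF refl])
    fix q assume "q \<in> S"
    have inv: "?inv p q \<longleftrightarrow> above q > 0 \<and> p = raise q" for p
      using raise_lower[of p] above_lower[of p] lower_raise[of q] below_raise[of q] by auto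
    show "(\<Sum>p\<in>S. if ?inv p q then real (below p) * real (above q) * ?c q else 0)
      = ?c q * real (above q * Suc (below q))"
    proof (cases "above q > 0 \<and> q \<in># X")
      case True
      then have "raise q \<in> S" by (auto simp: S_def)
      then show ?thesis unfolding inv using True S(1) below_raise[of q] by (simp add: algebra_simps)
    qed (auto simp: inv not_in_iff intro!: sum.neutral)
  qed
  also have "(\<Sum>p\<in>S. ?c p * real (below p * Suc (above p))) - (\<Sum>q\<in>S. ?c q * real (above q * Suc (below q)))
    = (\<Sum>p\<in>S. ?c p * (real (below p) - real (above p)))"
    by (simp add: sum_subtractf[symmetric] algebra_simps)
  also have "\<dots> = (\<Sum>p\<in>set_mset X. ?c p * (real (below p) - real (above p)))"
    using S by (intro sum.mono_neutral_right) (auto simp: not_in_iff)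
  also have "\<dots> = real_of_int (weight X)"
    by (simp add: weight_eq_sum)
  finally show ?thesis .
qed

lemma lower_total:
  assumes "amp lower below X p \<noteq> 0"
  shows "weight (shift lower p X) = weight X - 2"
    and "sum_mset (image_mset above (shift lower p X)) = Suc (sum_mset (image_mset above X))"
proof -
  obtain Y where X: "X = add_mset p Y"
    using amp_nonzero(1)[OF assms] by (metis insert_DiffM)
  have pos: "below p > 0" using amp_nonzero(2)[OF assms] .
  have "int (below (lower p)) = int (below p) - 1" "above (lower p) = Suc (above p)"
    using below_lower[OF pos] above_lower[OF pos] by linarith+
  then show "weight (shift lower p X) = weight X - 2"
    and "sum_mset (image_mset above (shift lower p X)) = Suc (sum_mset (image_mset above X))"
    by (simp_all add: X weight_def shift_def)
qed

text \<open>
  The injectivity of \<open>R\<close> on functions of positive weight, turned into an inequality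
  of cardinalities. The set \<open>B\<close> has to contain every configuration from which a raising move enters
  \<open>A\<close>, so that the equations indexed by \<open>B\<close> express that \<open>R x\<close> vanishes on all admissible
  configurations.
\<close>

theorem card_le_if_weight_pos:
  assumes fin: "finite A" "finite B"
    and adm: "\<And>X. X \<in> A \<Longrightarrow> admissible X"
    and wt: "\<And>X. X \<in> A \<Longrightarrow> weight X = h" and h: "h > 0"
    and into_B: "\<And>X p. admissible X \<Longrightarrow> amp raise above X p \<noteq> 0 \<Longrightarrow> shift raise p X \<in> A \<Longrightarrow> X \<in> B"
  shows "card A \<le> card B"
proof (rule ccontr)
  assume "\<not> card A \<le> card B"
  then have "card B < card A" by simp
  from exists_nontrivial_solution[OF fin(2,1) this,
      of "\<lambda>Y X. \<Sum>p\<in>set_mset Y. amp raise above Y p * (if shift raise p Y = X then 1 else 0)"]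
  obtain x where x: "\<exists>X\<in>A. x X \<noteq> 0" "\<And>X. X \<notin> A \<Longrightarrow> x X = 0"
    and eq: "\<And>Y. Y \<in> B \<Longrightarrow>
      (\<Sum>X\<in>A. (\<Sum>p\<in>set_mset Y. amp raise above Y p * (if shift raise p Y = X then 1 else 0)) * x X) = 0"
    by blast
  have Rx: "R x Y = 0" if "admissible Y" for Y
  proof (cases "Y \<in> B")
    case True
    have "R x Y = (\<Sum>p\<in>set_mset Y. \<Sum>X\<in>A.
        amp raise above Y p * (if shift raise p Y = X then 1 else 0) * x X)"
      unfolding hop_def
    proof (rule sum.cong[OF refl])
      fix p
      have "(\<Sum>X\<in>A. amp raise above Y p * (if shift raise p Y = X then 1 else 0) * x X)
        = (\<Sum>X\<in>A. if shift raise p Y = X then amp raise above Y p * x X else 0)"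
        by (intro sum.cong) auto
      also have "\<dots> = amp raise above Y p * x (shift raise p Y)"
        using fin(1) x(2) by simp
      finally show "amp raise above Y p * x (shift raise p Y) =
        (\<Sum>X\<in>A. amp raise above Y p * (if shift raise p Y = X then 1 else 0) * x X)" ..
    qed
    also have "\<dots> = 0" using eq[OF True] by (subst sum.swap) (simp add: sum_distrib_right)
    finally show ?thesis .
  next
    case False
    then show ?thesis unfolding hop_def using into_B[OF that] x(2)
      by (intro sum.neutral) (metis mult_eq_0_iff)
  qed
  define f where "f k = (L ^^ k) x" for k
  have f_0: "f 0 = x" and f_Suc: "f (Suc k) = L (f k)" for k by (simp_all add: f_def)
  \<comment> \<open>A lowering move increases the total of \<open>above\<close>, so the bound \<open>N\<close> on \<open>A\<close> limits the number of moves
    that end in \<open>A\<close>.\<close>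
  define N where "N = Max ((\<lambda>X. sum_mset (image_mset above X)) ` A)"
  have support: "weight X = h + 2 * int k \<and> sum_mset (image_mset above X) + k \<le> N"
    if "f k X \<noteq> 0" for k X using that
  proof (induction k arbitrary: X)
    case 0
    then have "X \<in> A" using x(2) f_0 by metis
    then show ?case using fin(1) wt by (auto simp: N_def)
  next
    case (Suc k)
    then obtain p where p: "amp lower below X p \<noteq> 0" "f k (shift lower p X) \<noteq> 0"
      unfolding f_Suc hop_def by (metis (no_types, lifting) mult_eq_0_iff sum.neutral)
    then show ?case using Suc.IH[OF p(2)] lower_total[OF p(1)] by auto
  qed
  \<comment> \<open>The factor \<open>c\<close> for \<open>k\<close> is the sum of the weights \<open>h\<close>, \<open>h + 2\<close>, ..., \<open>h + 2 k\<close>.\<close>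
  have R_step: "\<exists>c>0. \<forall>X. admissible X \<longrightarrow> R (f (Suc k)) X = - c * f k X" for k
  proof -
    have "\<exists>c\<ge>0. \<forall>X. admissible X \<longrightarrow> L (R (f k)) X = - c * f k X"
    proof (induction k)
      case 0
      have "L (R (f 0)) X = L (\<lambda>_. 0) X" if "admissible X" for X
        using that Rx admissible_lower by (intro hop_cong_admissible) (auto simp: f_0)
      then have "L (R (f 0)) X = 0" if "admissible X" for X
        using that by (simp add: hop_def)
      then show ?case by (intro exI[of _ 0]) auto
    next
      case (Suc k)
      then obtain c where c: "c \<ge> 0" "\<And>X. admissible X \<Longrightarrow> L (R (f k)) X = - c * f k X" by blast
      let ?c = "c + of_int (h + 2 * int k)"
      have R: "R (f (Suc k)) X = - ?c * f k X" if "admissible X" for X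
        using commutator[OF that, of "f k"] c(2)[OF that] support[of k X]
        by (cases "f k X = 0") (auto simp: f_Suc algebra_simps)
      have "L (R (f (Suc k))) X = L (\<lambda>X. - ?c * f k X) X" if "admissible X" for X
        using that R admissible_lower by (intro hop_cong_admissible) auto
      also have "L (\<lambda>X. - ?c * f k X) X = - ?c * f (Suc k) X" for X
        by (simp only: f_Suc hop_def sum_distrib_left ac_simps)
      finally show ?case using c(1) h by (intro exI[of _ ?c]) auto
    qed
    then obtain c where c: "c \<ge> 0" "\<And>X. admissible X \<Longrightarrow> L (R (f k)) X = - c * f k X" by blast
    let ?c = "c + of_int (h + 2 * int k)"
    have "R (f (Suc k)) X = - ?c * f k X" if "admissible X" for X
      using commutator[OF that, of "f k"] c(2)[OF that] support[of k X]
      by (cases "f k X = 0") (auto simp: f_Suc algebra_simps)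
    moreover have "?c > 0" using c(1) h by auto
    ultimately show ?thesis by blast
  qed
  have f_zero: "f k X = 0" if "admissible X" "k \<le> Suc N" for k X
    using that(2,1)
  proof (induction k arbitrary: X rule: inc_induct)
    case base
    then show ?case using support[of "Suc N" X] by fastforce
  next
    case (step k)
    obtain c where c: "c > 0" "\<And>X. admissible X \<Longrightarrow> R (f (Suc k)) X = - c * f k X"
      using R_step by blast
    have "R (f (Suc k)) X = R (\<lambda>_. 0) X"
      using step by (intro hop_cong_admissible) (auto simp: admissible_raise)
    then have "R (f (Suc k)) X = 0" by (simp add: hop_def)
    then show ?case using c step.prems by simp
  qed
  obtain X where "X \<in> A" "x X \<noteq> 0" using x(1) by blast
  then show False using f_zero[of X 0] adm f_0 by auto
qed

end

section \<open>Superpartitions as configurations\<close>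

text \<open>
  \<open>Inl\<close> marks the sites of the parts \<open>v\<^sub>i\<close>, \<open>Inr\<close> those of the parts \<open>v'\<^sub>j\<close>. The pairs \<open>(0, 1)\<close> and
  \<open>(1, 0)\<close> under \<open>Inr\<close> form a chain of length two; every other site under \<open>Inr\<close> is a chain by itself,
  so \<open>above_site\<close> and \<open>below_site\<close> are \<open>0\<close> there. This is what keeps the parts \<open>v'\<^sub>j\<close> in
  \<open>{0, 1} \<times> {0, 1}\<close>.
\<close>

type_synonym site = "(nat \<times> nat) + (nat \<times> nat)"

definition lower_site :: "site \<Rightarrow> site" where
  "lower_site = map_sum (\<lambda>(i, j). (i - 1, j + 1)) (\<lambda>(i, j). (i - 1, j + 1))"

definition raise_site :: "site \<Rightarrow> site" where
  "raise_site = map_sum (\<lambda>(i, j). (i + 1, j - 1)) (\<lambda>(i, j). (i + 1, j - 1))"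

definition below_site :: "site \<Rightarrow> nat" where
  "below_site = case_sum (\<lambda>(i, j). i) (\<lambda>(i, j). if i + j = 1 then i else 0)"

definition above_site :: "site \<Rightarrow> nat" where
  "above_site = case_sum (\<lambda>(i, j). j) (\<lambda>(i, j). if i + j = 1 then j else 0)"

definition exclusive_site :: "char_label \<Rightarrow> char_label \<Rightarrow> site \<Rightarrow> bool" where
  "exclusive_site \<zeta> \<theta> = case_sum (\<lambda>_. \<zeta> = Sgn) (\<lambda>x. x \<in> nonrepeatable \<theta>)"

lemmas site_defs = lower_site_def raise_site_def below_site_def above_site_def exclusive_site_def

lemma ladder_sites: "ladder lower_site raise_site below_site above_site (exclusive_site \<zeta> \<theta>)"
proof (unfold_locales, goal_cases)
  case (1 p) then show ?case by (cases p) (auto simp: site_defs split: if_splits)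
next
  case (2 p) then show ?case by (cases p) (auto simp: site_defs split: if_splits)
next
  case (3 p) then show ?case by (cases p) (auto simp: site_defs split: if_splits)
next
  case (4 p) then show ?case by (cases p; cases \<theta>) (auto simp: site_defs split: if_splits)
next
  case (5 p) then show ?case by (cases p) (auto simp: site_defs split: if_splits)
next
  case (6 p) then show ?case by (cases p) (auto simp: site_defs split: if_splits)
next
  case (7 p) then show ?case by (cases p) (auto simp: site_defs split: if_splits)
next
  case (8 p) then show ?case by (cases p; cases \<theta>) (auto simp: site_defs split: if_splits)
qed

definition config :: "(nat \<times> nat) multiset \<Rightarrow> (nat \<times> nat) multiset \<Rightarrow> site multiset" where
  "config M N = image_mset Inl M + image_mset Inr N"

lemma config_add_mset:
  "config (add_mset x M) N = add_mset (Inl x) (config M N)"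
  "config M (add_mset x N) = add_mset (Inr x) (config M N)"
  by (simp_all add: config_def)

lemma exists_config: "\<exists>M N. X = config M N"
proof (induction X)
  case empty
  then show ?case by (metis config_def image_mset_empty add_0)
next
  case (add p X)
  then show ?case by (cases p) (metis config_add_mset)+
qed

lemma config_inject: "config M N = config M' N' \<longleftrightarrow> M = M' \<and> N = N'"
proof -
  have "image_mset projl (filter_mset isl (config M N)) = M"
    "image_mset projr (filter_mset (\<lambda>s. \<not> isl s) (config M N)) = N" for M N
    by (simp_all add: config_def filter_mset_image_mset multiset.map_comp comp_def)
  then show ?thesis by metis
qed

lemma count_config: "count (config M N) (Inl x) = count M x" "count (config M N) (Inr x) = count N x"
proof -
  have "count (image_mset Inl M) (Inl x) = count M x" "count (image_mset Inl M) (Inr x) = 0"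
    by (induction M) auto
  moreover have "count (image_mset Inr N) (Inr x) = count N x" "count (image_mset Inr N) (Inl x) = 0"
    by (induction N) auto
  ultimately show "count (config M N) (Inl x) = count M x" "count (config M N) (Inr x) = count N x"
    by (simp_all add: config_def)
qed

definition configs :: "char_label \<Rightarrow> nat \<Rightarrow> char_label \<Rightarrow> nat \<Rightarrow> nat \<times> nat \<Rightarrow> site multiset set" where
  "configs \<zeta> m \<theta> n \<alpha> = {config M N | M N. size M = m \<and> size N = n \<and> set_mset N \<subseteq> {0, 1} \<times> {0, 1} \<and>
     (\<forall>p. exclusive_site \<zeta> \<theta> p \<longrightarrow> count (config M N) p \<le> 1) \<and> sum_mset M + sum_mset N = \<alpha>}"

lemma distinct_iff_count_le_1: "distinct v \<longleftrightarrow> (\<forall>x. count (mset v) x \<le> 1)"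
proof
  assume "\<forall>x. count (mset v) x \<le> 1"
  then have "count (mset v) x = (if x \<in> set v then 1 else 0)" for x
    using count_greater_zero_iff[of "mset v" x] by (cases "x \<in> set v") (auto simp: le_Suc_eq)
  then show "distinct v" by (simp add: distinct_count_atmost_1)
qed (simp add: distinct_count_atmost_1)

lemma distinct_iff_nth_less:
  "distinct v \<longleftrightarrow> (\<forall>i j. i < j \<and> j < length v \<longrightarrow> v ! i \<noteq> v ! j)"
proof
  assume nth_neq: "\<forall>i j. i < j \<and> j < length v \<longrightarrow> v ! i \<noteq> v ! j"
  have "v ! i \<noteq> v ! j" if "i < length v" "j < length v" "i \<noteq> j" for i j
    using nth_neq that by (cases i j rule: linorder_cases) fastforce+
  then show "distinct v" by (simp add: distinct_conv_nth)
qed (auto simp: distinct_conv_nth)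

text \<open>A weakly increasing tuple is determined by its multiset of entries.\<close>

lemma bij_betw_configs:
  "bij_betw (\<lambda>(v, v'). config (mset v) (mset v'))
     (bipartite_superpartitions \<zeta> m \<theta> n \<alpha>) (configs \<zeta> m \<theta> n \<alpha>)"
proof -
  have excl: "(\<forall>p. exclusive_site \<zeta> \<theta> p \<longrightarrow> count (config M N) p \<le> 1) \<longleftrightarrow>
      (\<zeta> = Sgn \<longrightarrow> (\<forall>x. count M x \<le> 1)) \<and> (\<forall>x\<in>nonrepeatable \<theta>. count N x \<le> 1)" for M N
    by (auto simp: exclusive_site_def count_config split_sum_all)
  have mem: "(v, v') \<in> bipartite_superpartitions \<zeta> m \<theta> n \<alpha> \<longleftrightarrow>
    sorted v \<and> sorted v' \<and> size (mset v) = m \<and> size (mset v') = n \<and>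
    set_mset (mset v') \<subseteq> {0, 1} \<times> {0, 1} \<and>
    (\<forall>p. exclusive_site \<zeta> \<theta> p \<longrightarrow> count (config (mset v) (mset v')) p \<le> 1) \<and>
    sum_mset (mset v) + sum_mset (mset v') = \<alpha>" for v v'
    unfolding excl distinct_iff_count_le_1[symmetric] distinct_iff_nth_less
    by (auto simp: bipartite_superpartitions_def count_mset sum_mset_sum_list)
  have sorted_unique: "v = w" if "sorted v" "sorted w" "mset v = mset w" for v w :: "(nat \<times> nat) list"
    using that by (metis properties_for_sort)
  show ?thesis
  proof (rule bij_betwI')
    fix a b assume "a \<in> bipartite_superpartitions \<zeta> m \<theta> n \<alpha>" "b \<in> bipartite_superpartitions \<zeta> m \<theta> n \<alpha>"
    then show "(case a of (v, v') \<Rightarrow> config (mset v) (mset v')) = (case b of (v, v') \<Rightarrow> config (mset v) (mset v'))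
      \<longleftrightarrow> a = b"
      using sorted_unique by (cases a; cases b) (auto simp: mem config_inject)
  next
    fix a assume a: "a \<in> bipartite_superpartitions \<zeta> m \<theta> n \<alpha>"
    obtain v v' where vv': "a = (v, v')" by (cases a)
    show "(case a of (v, v') \<Rightarrow> config (mset v) (mset v')) \<in> configs \<zeta> m \<theta> n \<alpha>"
      using a unfolding vv' mem configs_def prod.case by blast
  next
    fix X assume "X \<in> configs \<zeta> m \<theta> n \<alpha>"
    then obtain M N where MN: "X = config M N" "size M = m \<and> size N = n \<and> set_mset N \<subseteq> {0, 1} \<times> {0, 1} \<and>
     (\<forall>p. exclusive_site \<zeta> \<theta> p \<longrightarrow> count (config M N) p \<le> 1) \<and> sum_mset M + sum_mset N = \<alpha>"
      unfolding configs_def by blast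
    then have "(sorted_list_of_multiset M, sorted_list_of_multiset N) \<in> bipartite_superpartitions \<zeta> m \<theta> n \<alpha>"
      unfolding mem by simp
    then show "\<exists>a\<in>bipartite_superpartitions \<zeta> m \<theta> n \<alpha>. X = (case a of (v, v') \<Rightarrow> config (mset v) (mset v'))"
      using MN(1) by force
  qed
qed

text \<open>
  On the chosen sites the difference \<open>below_site - above_site\<close> of \<open>(a, b)\<close> is \<open>a - b\<close>, also for the
  isolated sites \<open>(0, 0)\<close> and \<open>(1, 1)\<close>. So the total \<open>(l1 + 1, l2 - 1)\<close> has weight \<open>l1 - l2 + 2 > 0\<close>.
\<close>

theorem proposition4p3:
  fixes m n l1 l2 :: nat and \<zeta> \<theta> :: char_label
  assumes "l1 \<ge> l2" and "l2 \<ge> 1"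
  shows "card (bipartite_superpartitions \<zeta> m \<theta> n (l1, l2))
    \<ge> card (bipartite_superpartitions \<zeta> m \<theta> n (l1 + 1, l2 - 1))"
proof -
  interpret ladder lower_site raise_site below_site above_site "exclusive_site \<zeta> \<theta>"
    by (rule ladder_sites)
  have card: "card (bipartite_superpartitions \<zeta> m \<theta> n \<alpha>) = card (configs \<zeta> m \<theta> n \<alpha>)"
    and fin: "finite (configs \<zeta> m \<theta> n \<alpha>)" for \<alpha>
    using bij_betw_same_card[OF bij_betw_configs] bij_betw_finite[OF bij_betw_configs]
      finite_bipartite_superpartitions by metis+
  have weight_config: "weight (config M N) = int (fst (sum_mset M + sum_mset N)) - int (snd (sum_mset M + sum_mset N))"
    if "set_mset N \<subseteq> {0, 1} \<times> {0, 1}" for M N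
  proof -
    have "(\<Sum>p\<in>#image_mset Inl M. int (below_site p) - int (above_site p)) = int (fst (sum_mset M)) - int (snd (sum_mset M))"
      by (induction M) (auto simp: below_site_def above_site_def)
    moreover have "(\<Sum>p\<in>#image_mset Inr N. int (below_site p) - int (above_site p)) = int (fst (sum_mset N)) - int (snd (sum_mset N))"
      using that by (induction N) (auto simp: below_site_def above_site_def)
    ultimately show ?thesis by (simp add: weight_def config_def)
  qed
  have "card (configs \<zeta> m \<theta> n (l1 + 1, l2 - 1)) \<le> card (configs \<zeta> m \<theta> n (l1, l2))"
  proof (rule card_le_if_weight_pos[OF fin fin])
    fix X assume "X \<in> configs \<zeta> m \<theta> n (l1 + 1, l2 - 1)"
    then show "admissible X" "weight X = int (l1 + 1) - int (l2 - 1)"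
      by (auto simp: configs_def admissible_def weight_config)
  next
    show "int (l1 + 1) - int (l2 - 1) > 0" using assms by simp
  next
    fix X p assume X: "admissible X" "amp raise_site above_site X p \<noteq> 0"
      and shifted: "shift raise_site p X \<in> configs \<zeta> m \<theta> n (l1 + 1, l2 - 1)"
    have p: "p \<in># X" "above_site p > 0" using amp_nonzero[OF X(2)] by auto
    obtain Y where Y: "X = add_mset p Y" using p(1) by (metis insert_DiffM)
    obtain M N where MN: "Y = config M N" using exists_config by blast
    show "X \<in> configs \<zeta> m \<theta> n (l1, l2)"
    proof (cases p)
      case (Inl v)
      obtain i j where v: "v = (i, j)" "j > 0" using p Inl by (cases v) (auto simp: above_site_def)
      have X_eq: "X = config (add_mset (i, j) M) N" using Y MN Inl v by (simp add: config_def)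
      have "shift raise_site p X = config (add_mset (i + 1, j - 1) M) N"
        using Y MN Inl v by (simp add: config_def shift_def raise_site_def)
      then show ?thesis using shifted X(1) v assms(2) unfolding X_eq
        by (auto simp: configs_def config_inject admissible_def prod_eq_iff)
    next
      case (Inr v)
      have v: "v = (0, 1)" using p Inr by (cases v) (auto simp: above_site_def split: if_splits)
      have X_eq: "X = config M (add_mset (0, 1) N)" using Y MN Inr v by (simp add: config_def)
      have "shift raise_site p X = config M (add_mset (1, 0) N)"
        using Y MN Inr v by (simp add: config_def shift_def raise_site_def)
      then show ?thesis using shifted X(1) assms(2) unfolding X_eq
        by (auto simp: configs_def config_inject admissible_def prod_eq_iff)
    qed
  qed
  then show ?thesis by (simp only: card)
qed

end
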